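(* Every poset that is meet distributive ($\mathbf{MD}$) has an $(\omega,3)$-representation.
   Context: A poset $P$ is $\mathbf{MD}$ (meet distributive) if for all $a,b,c\in P$, if $a\wedge(b\vee c)$ is defined in $P$ then $(a\wedge b)\vee(a\wedge c)$ is also defined in $P$ (in particular $a\wedge b$ and $a\wedge c$ exist) and the two are equal. For cardinals $\alpha,\beta$, a poset $P$ is $(\alpha,\beta)$-representable (has an $(\alpha,\beta)$-representation) if there is an order embedding $h:P\to F$, where $F$ is a powerset algebra (the full powerset of some set, with union and intersection), such that $h$ preserves those meets existing in $P$ of sets with cardinality strictly less than $\alpha$, and those joins existing in $P$ of sets with cardinality strictly less than $\beta$. *)

theory Defs
  imports "HOL-Algebra.Lattice" "HOL-Library.FuncSet"
begin

unbundle cardinal_syntax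

text \<open>
  Meets and joins in a poset are partial, so they are treated relationally: \<open>is_glb P m A\<close>
  says that the meet of \<open>A\<close> is defined and equal to \<open>m\<close>. (The operations \<open>meet\<close> and \<open>join\<close> of
  the library are unspecified when the bound does not exist.) Below, \<open>b \<or> c\<close> is \<open>d\<close> and
  \<open>a \<and> (b \<or> c)\<close> is \<open>e\<close>.
\<close>

definition meet_distributive :: "('a, 'm) gorder_scheme \<Rightarrow> bool" where
  "meet_distributive P \<longleftrightarrow>
    (\<forall>a\<in>carrier P. \<forall>b\<in>carrier P. \<forall>c\<in>carrier P. \<forall>d e.
       is_lub P d {b, c} \<and> is_glb P e {a, d} \<longrightarrow>
       (\<exists>x y. is_glb P x {a, b} \<and> is_glb P y {a, c} \<and> is_lub P e {x, y}))"

definition powerset_algebra :: "'x set \<Rightarrow> 'x set gorder" where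
  "powerset_algebra X = \<lparr>carrier = Pow X, eq = (=), le = (\<subseteq>)\<rparr>"

text \<open>
  Cardinals are given as relations, as in the library: \<open>|S| <o \<alpha>\<close> says that \<open>S\<close> has cardinality
  strictly less than \<open>\<alpha>\<close>. The empty set is not excluded: a greatest element of \<open>P\<close> is the meet of
  the empty set and then has to be sent to \<open>X\<close>, which is the empty meet in the powerset algebra
  (whence \<open>X \<inter> \<Inter>(h ` S)\<close>), and a least element to the empty set.
\<close>

definition representation ::
  "'c rel \<Rightarrow> 'd rel \<Rightarrow> ('a, 'm) gorder_scheme \<Rightarrow> 'x set \<Rightarrow> ('a \<Rightarrow> 'x set) \<Rightarrow> bool" where
  "representation \<alpha> \<beta> P X h \<longleftrightarrow>
     h \<in> carrier P \<rightarrow> carrier (powerset_algebra X) \<and>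
     order_emb P (powerset_algebra X) h \<and>
     (\<forall>S m. S \<subseteq> carrier P \<and> |S| <o \<alpha> \<and> is_glb P m S \<longrightarrow> h m = X \<inter> \<Inter>(h ` S)) \<and>
     (\<forall>S j. S \<subseteq> carrier P \<and> |S| <o \<beta> \<and> is_lub P j S \<longrightarrow> h j = \<Union>(h ` S))"

text \<open>
  One cannot quantify over the type of the points of \<open>X\<close>. Taking the points to be sets of elements
  of \<open>P\<close> is no restriction, by the lemma \<open>representableI\<close> below: in an arbitrary representation, a
  point \<open>x\<close> can be replaced by the set of all \<open>p\<close> with \<open>x \<in> h p\<close>.
\<close>

definition representable :: "'c rel \<Rightarrow> 'd rel \<Rightarrow> ('a, 'm) gorder_scheme \<Rightarrow> bool" where
  "representable \<alpha> \<beta> P \<longleftrightarrow> (\<exists>(X :: 'a set set) h. representation \<alpha> \<beta> P X h)"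

lemma representableI:
  fixes X :: "'x set" and P :: "('a, 'm) gorder_scheme"
  assumes rep: "representation \<alpha> \<beta> P X h"
  shows "representable \<alpha> \<beta> P"
proof -
  define T where "T x = {p \<in> carrier P. x \<in> h p}" for x
  define k where "k p = T ` h p" for p
  have sub: "h p \<subseteq> X" if "p \<in> carrier P" for p
    using rep that by (auto simp: representation_def powerset_algebra_def)
  have T_iff: "T x \<in> k p \<longleftrightarrow> x \<in> h p" if "p \<in> carrier P" for x p
    using that by (auto simp: k_def T_def)
  have k_sub: "k p \<subseteq> T ` X" if "p \<in> carrier P" for p
    using sub[OF that] by (auto simp: k_def)
  have k_le: "k p \<subseteq> k q \<longleftrightarrow> h p \<subseteq> h q" if "p \<in> carrier P" "q \<in> carrier P" for p q
  proof
    assume "k p \<subseteq> k q"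
    then show "h p \<subseteq> h q" using T_iff that by blast
  qed (auto simp: k_def)
  have "k \<in> carrier P \<rightarrow> carrier (powerset_algebra (T ` X))"
    using k_sub by (auto simp: powerset_algebra_def)
  moreover have "order_emb P (powerset_algebra (T ` X)) k"
  proof -
    have "weak_partial_order (powerset_algebra (T ` X))"
      by unfold_locales (auto simp: powerset_algebra_def)
    then show ?thesis
      using rep k_le by (auto simp: representation_def order_emb_def powerset_algebra_def)
  qed
  moreover have "k m = T ` X \<inter> \<Inter>(k ` S)"
    if S: "S \<subseteq> carrier P" "|S| <o \<alpha>" "is_glb P m S" for S m
  proof -
    have m: "m \<in> carrier P" using S(3) by (auto simp: greatest_def Lower_def)
    have hm: "h m = X \<inter> \<Inter>(h ` S)" using rep S by (auto simp: representation_def)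
    have "T x \<in> k m \<longleftrightarrow> T x \<in> \<Inter>(k ` S)" if "x \<in> X" for x
    proof -
      have "T x \<in> \<Inter>(k ` S) \<longleftrightarrow> (\<forall>p\<in>S. x \<in> h p)"
        using T_iff S(1) by (simp add: subset_iff)
      then show ?thesis using T_iff[OF m] hm that by simp
    qed
    then show ?thesis using k_sub[OF m] by auto
  qed
  moreover have "k j = \<Union>(k ` S)"
    if S: "S \<subseteq> carrier P" "|S| <o \<beta>" "is_lub P j S" for S j
  proof -
    have "h j = \<Union>(h ` S)" using rep S by (auto simp: representation_def)
    then show ?thesis by (simp add: k_def image_UN)
  qed
  ultimately have "representation \<alpha> \<beta> P (T ` X) k"
    unfolding representation_def by simp
  then show ?thesis unfolding representable_def by blast
qed

lemma card_of_less_nat_iff: "|S| <o |{..<n::nat}| \<longleftrightarrow> finite S \<and> card S < n"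
proof -
  have "|S| <o |{..<n}| \<longleftrightarrow> \<not> (\<exists>f. inj_on f {..<n} \<and> f ` {..<n} \<subseteq> S)"
    by (rule card_of_ordLess [symmetric])
  also have "\<dots> \<longleftrightarrow> finite S \<and> card S < n"
  proof (cases "finite S")
    case True
    have "(\<exists>f. inj_on f {..<n} \<and> f ` {..<n} \<subseteq> S) \<longleftrightarrow> n \<le> card S"
    proof
      assume "\<exists>f. inj_on f {..<n} \<and> f ` {..<n} \<subseteq> S"
      then show "n \<le> card S"
        using True card_inj_on_le[of _ "{..<n}" S] by (metis card_lessThan)
    next
      assume "n \<le> card S"
      then show "\<exists>f. inj_on f {..<n} \<and> f ` {..<n} \<subseteq> S"
        using True card_le_inj[of "{..<n}" S] by (metis card_lessThan finite_lessThan)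
    qed
    then show ?thesis using True by auto
  next
    case False
    then obtain f :: "nat \<Rightarrow> 'a" where "inj f" "range f \<subseteq> S"
      using infinite_countable_subset by blast
    then have "inj_on f {..<n} \<and> f ` {..<n} \<subseteq> S"
      by (auto intro: inj_on_subset)
    then show ?thesis using False by blast
  qed
  finally show ?thesis .
qed

end

theory Submission
  imports Defs
begin

text \<open>
  The points of the representation are the down-directed up-sets \<open>F\<close> of \<open>P\<close> that are prime for the
  existing binary joins and omit the least element, if there is one;
  \<open>h a\<close> is the set of those containing \<open>a\<close>.
  A down-directed up-set contains every existing meet of its finite subsets, because it contains
  some lower bound of the subset; so \<open>h\<close> preserves finite meets, and primeness makes it preserve
  joins of at most two elements. It remains to separate: if \<open>p \<not>\<le> q\<close>, some such \<open>F\<close> contains \<open>p\<close>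
  but not \<open>q\<close>. By Zorn's lemma there is a maximal down-directed up-set \<open>F\<close> with \<open>p \<in> F\<close> and
  \<open>q \<notin> F\<close>, and it is prime. For suppose that \<open>d = b \<or> c\<close> lies in \<open>F\<close>, but neither \<open>b\<close> nor \<open>c\<close>
  does. Meet distributivity, applied to \<open>f = f \<and> d\<close>, says that for all \<open>f \<in> F\<close> below \<open>d\<close> the meets
  \<open>f \<and> b\<close> and \<open>f \<and> c\<close> exist and \<open>f\<close> is their join. By directedness these \<open>f\<close> are coinitial in \<open>F\<close>, so
  the elements above some \<open>f \<and> b\<close> form a down-directed up-set that contains \<open>F\<close> and \<open>b\<close>, and
  hence \<open>q\<close>, by maximality; likewise for \<open>c\<close>. Then a single \<open>f \<in> F\<close> has both \<open>f \<and> b \<le> q\<close> and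
  \<open>f \<and> c \<le> q\<close>, so \<open>f \<le> q\<close> and \<open>q \<in> F\<close>, a contradiction.

  Both the coinitiality and the choice of a single \<open>f\<close> for \<open>b\<close> and \<open>c\<close> rest on directedness.
  Closure under the existing finite meets is weaker, since two
  elements of \<open>F\<close> may have no meet, and for that weaker notion of filter the elements \<open>f\<close> below \<open>d\<close>
  need not be coinitial.
\<close>

section \<open>Directed and prime filters\<close>

definition directed_filter :: "('a, 'm) gorder_scheme \<Rightarrow> 'a set \<Rightarrow> bool" where
  "directed_filter P F \<longleftrightarrow>
     F \<subseteq> carrier P \<and> F \<noteq> {} \<and>
     (\<forall>x\<in>F. \<forall>y\<in>carrier P. x \<sqsubseteq>\<^bsub>P\<^esub> y \<longrightarrow> y \<in> F) \<and>
     (\<forall>x\<in>F. \<forall>y\<in>F. \<exists>z\<in>F. z \<sqsubseteq>\<^bsub>P\<^esub> x \<and> z \<sqsubseteq>\<^bsub>P\<^esub> y)"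

definition prime_filter :: "('a, 'm) gorder_scheme \<Rightarrow> 'a set \<Rightarrow> bool" where
  "prime_filter P F \<longleftrightarrow>
     directed_filter P F \<and>
     (\<forall>j. is_lub P j {} \<longrightarrow> j \<notin> F) \<and>
     (\<forall>b\<in>carrier P. \<forall>c\<in>carrier P. \<forall>d. is_lub P d {b, c} \<and> d \<in> F \<longrightarrow> b \<in> F \<or> c \<in> F)"

lemma is_glb_pair_iff:
  assumes "a \<in> carrier P" "b \<in> carrier P"
  shows "is_glb P m {a, b} \<longleftrightarrow>
    m \<in> carrier P \<and> m \<sqsubseteq>\<^bsub>P\<^esub> a \<and> m \<sqsubseteq>\<^bsub>P\<^esub> b \<and>
    (\<forall>l\<in>carrier P. l \<sqsubseteq>\<^bsub>P\<^esub> a \<and> l \<sqsubseteq>\<^bsub>P\<^esub> b \<longrightarrow> l \<sqsubseteq>\<^bsub>P\<^esub> m)"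
  using assms by (auto simp: greatest_def Lower_def)

lemma is_lub_pair_iff:
  assumes "a \<in> carrier P" "b \<in> carrier P"
  shows "is_lub P j {a, b} \<longleftrightarrow>
    j \<in> carrier P \<and> a \<sqsubseteq>\<^bsub>P\<^esub> j \<and> b \<sqsubseteq>\<^bsub>P\<^esub> j \<and>
    (\<forall>u\<in>carrier P. a \<sqsubseteq>\<^bsub>P\<^esub> u \<and> b \<sqsubseteq>\<^bsub>P\<^esub> u \<longrightarrow> j \<sqsubseteq>\<^bsub>P\<^esub> u)"
  using assms by (auto simp: least_def Upper_def)

lemma Lower_pair_iff:
  assumes "a \<in> carrier P" "b \<in> carrier P"
  shows "l \<in> Lower P {a, b} \<longleftrightarrow> l \<in> carrier P \<and> l \<sqsubseteq>\<^bsub>P\<^esub> a \<and> l \<sqsubseteq>\<^bsub>P\<^esub> b"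
  using assms by (auto simp: Lower_def)

text \<open>
  When the meets \<open>f \<and> b\<close> exist for all \<open>f\<close> in a coinitial part of \<open>F\<close>, this is the set of all elements
  above one of them. Bounding all common lower bounds of \<open>f\<close> and \<open>b\<close> instead of their meet makes the
  set contain \<open>F\<close> and \<open>b\<close> and be upward closed whether or not any meets exist.
\<close>

definition adjoin :: "('a, 'm) gorder_scheme \<Rightarrow> 'a set \<Rightarrow> 'a \<Rightarrow> 'a set" where
  "adjoin P F b = {x \<in> carrier P. \<exists>f\<in>F. \<forall>l\<in>Lower P {f, b}. l \<sqsubseteq>\<^bsub>P\<^esub> x}"

context weak_partial_order
begin

lemma directed_filter_principal:
  assumes "p \<in> carrier L"
  shows "directed_filter L {x \<in> carrier L. p \<sqsubseteq> x}"
  using assms le_trans le_refl unfolding directed_filter_def by blast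

lemma directed_filter_finite_lower_bound:
  assumes F: "directed_filter L F" and "finite S" "S \<subseteq> F"
  shows "\<exists>z\<in>F. \<forall>s\<in>S. z \<sqsubseteq> s"
  using assms(2,3)
proof (induction S rule: finite_induct)
  case empty
  then show ?case using F by (auto simp: directed_filter_def)
next
  case (insert s S)
  then obtain z where z: "z \<in> F" "\<forall>t\<in>S. z \<sqsubseteq> t" by auto
  with insert.prems F obtain w where w: "w \<in> F" "w \<sqsubseteq> z" "w \<sqsubseteq> s"
    unfolding directed_filter_def by (meson insert_subset)
  have carr: "F \<subseteq> carrier L" using F by (simp add: directed_filter_def)
  have "w \<sqsubseteq> t" if "t \<in> S" for t
    using le_trans[of w z t] w(1,2) z that carr insert.prems by blast
  with w show ?case by auto
qed

lemma directed_filter_is_glb_iff: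
  assumes F: "directed_filter L F" and S: "finite S" "S \<subseteq> carrier L" and m: "is_glb L m S"
  shows "m \<in> F \<longleftrightarrow> S \<subseteq> F"
proof
  assume "m \<in> F"
  moreover have "m \<sqsubseteq> s" if "s \<in> S" for s
    using m S that by (auto simp: greatest_def Lower_def)
  ultimately show "S \<subseteq> F" using F S by (auto simp: directed_filter_def)
next
  assume "S \<subseteq> F"
  then obtain z where z: "z \<in> F" "\<forall>s\<in>S. z \<sqsubseteq> s"
    using directed_filter_finite_lower_bound[OF F S(1)] by blast
  then have "z \<sqsubseteq> m" "m \<in> carrier L"
    using m F by (auto simp: greatest_def Lower_def directed_filter_def)
  then show "m \<in> F" using F z by (auto simp: directed_filter_def)
qed

lemma prime_filter_is_lub_iff:
  assumes F: "prime_filter L F" and S: "finite S" "card S < 3" "S \<subseteq> carrier L"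
    and j: "is_lub L j S"
  shows "j \<in> F \<longleftrightarrow> S \<inter> F \<noteq> {}"
proof
  assume jF: "j \<in> F"
  from S(2) consider "card S = 0" | "card S = 1" | "card S = 2" by linarith
  then have "S = {} \<or> (\<exists>b c. S = {b, c})"
  proof cases
    case 1 then show ?thesis using S by auto
  next
    case 2 then show ?thesis by (metis card_1_singletonE insert_absorb2)
  next
    case 3 then show ?thesis by (auto simp: card_2_iff)
  qed
  then show "S \<inter> F \<noteq> {}"
  proof (elim disjE exE)
    assume "S = {}"
    then show ?thesis using F j jF by (auto simp: prime_filter_def)
  next
    fix b c
    assume bc: "S = {b, c}"
    then have "b \<in> carrier L" "c \<in> carrier L" "is_lub L j {b, c}"
      using S(3) j by simp_all
    then have "b \<in> F \<or> c \<in> F"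
      using F jF unfolding prime_filter_def by blast
    then show ?thesis using bc by auto
  qed
next
  assume "S \<inter> F \<noteq> {}"
  then obtain s where s: "s \<in> S" "s \<in> F" by auto
  then have "s \<sqsubseteq> j" "j \<in> carrier L"
    using j S by (auto simp: least_def Upper_def)
  then show "j \<in> F" using F s by (auto simp: prime_filter_def directed_filter_def)
qed

section \<open>Adjoining an element to a directed filter\<close>

lemma subset_adjoin:
  assumes "directed_filter L F" "b \<in> carrier L"
  shows "F \<subseteq> adjoin L F b"
proof
  fix x
  assume "x \<in> F"
  moreover from this have "x \<in> carrier L" using assms(1) by (auto simp: directed_filter_def)
  moreover from this have "\<forall>l\<in>Lower L {x, b}. l \<sqsubseteq> x"
    using assms(2) by (simp add: Lower_pair_iff)
  ultimately show "x \<in> adjoin L F b" by (auto simp: adjoin_def)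
qed

lemma mem_adjoin:
  assumes "directed_filter L F" "b \<in> carrier L"
  shows "b \<in> adjoin L F b"
proof -
  obtain f where "f \<in> F" "f \<in> carrier L"
    using assms(1) unfolding directed_filter_def by blast
  moreover from this have "\<forall>l\<in>Lower L {f, b}. l \<sqsubseteq> b"
    using assms(2) by (simp add: Lower_pair_iff)
  ultimately show ?thesis using assms(2) by (auto simp: adjoin_def)
qed

text \<open>
  Given two elements of the extension that bound the common lower bounds of \<open>f, b\<close> and of \<open>f', b\<close>,
  directedness and coinitiality yield some \<open>g \<in> F\<close> below \<open>f\<close> and \<open>f'\<close> that has a meet with \<open>b\<close>.
  This meet is the required lower bound, and it lies in the extension because it is a greatest one.
\<close>

lemma directed_filter_adjoin:
  assumes F: "directed_filter L F" and b: "b \<in> carrier L"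
    and coinitial: "\<And>f. f \<in> F \<Longrightarrow> \<exists>g\<in>F. g \<sqsubseteq> f \<and> (\<exists>m. is_glb L m {g, b})"
  shows "directed_filter L (adjoin L F b)"
proof -
  have carr: "F \<subseteq> carrier L" using F by (simp add: directed_filter_def)
  have up: "y \<in> adjoin L F b" if "x \<in> adjoin L F b" "y \<in> carrier L" "x \<sqsubseteq> y" for x y
  proof -
    obtain f where f: "f \<in> F" "\<forall>l\<in>Lower L {f, b}. l \<sqsubseteq> x"
      using \<open>x \<in> adjoin L F b\<close> by (auto simp: adjoin_def)
    have "l \<sqsubseteq> y" if "l \<in> Lower L {f, b}" for l
      using le_trans[of l x y] f that \<open>x \<in> adjoin L F b\<close> \<open>y \<in> carrier L\<close> \<open>x \<sqsubseteq> y\<close>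
      by (auto simp: adjoin_def Lower_def)
    then show ?thesis using f(1) \<open>y \<in> carrier L\<close> unfolding adjoin_def by blast
  qed
  have dir: "\<exists>z\<in>adjoin L F b. z \<sqsubseteq> x \<and> z \<sqsubseteq> y"
    if x: "x \<in> adjoin L F b" and y: "y \<in> adjoin L F b" for x y
  proof -
    obtain f where f: "f \<in> F" "\<forall>l\<in>Lower L {f, b}. l \<sqsubseteq> x"
      using x by (auto simp: adjoin_def)
    obtain f' where f': "f' \<in> F" "\<forall>l\<in>Lower L {f', b}. l \<sqsubseteq> y"
      using y by (auto simp: adjoin_def)
    obtain g0 where g0: "g0 \<in> F" "g0 \<sqsubseteq> f" "g0 \<sqsubseteq> f'"
      using F f(1) f'(1) unfolding directed_filter_def by blast
    obtain g m where g: "g \<in> F" "g \<sqsubseteq> g0" and glb: "is_glb L m {g, b}"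
      using coinitial[OF g0(1)] by blast
    have in_carr: "f \<in> carrier L" "f' \<in> carrier L" "g0 \<in> carrier L" "g \<in> carrier L"
      using f(1) f'(1) g0(1) g(1) carr by blast+
    have m: "m \<in> carrier L" "m \<sqsubseteq> g" "m \<sqsubseteq> b"
      using glb in_carr b by (simp_all add: is_glb_pair_iff)
    have "m \<sqsubseteq> g0" using le_trans[OF m(2) g(2)] m in_carr by simp
    then have "m \<sqsubseteq> f" "m \<sqsubseteq> f'"
      using le_trans[OF _ g0(2)] le_trans[OF _ g0(3)] m in_carr by simp_all
    then have "m \<in> Lower L {f, b}" "m \<in> Lower L {f', b}"
      using m in_carr b by (simp_all add: Lower_pair_iff)
    then have "m \<sqsubseteq> x" "m \<sqsubseteq> y" using f f' by auto
    moreover have "m \<in> adjoin L F b"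
      using glb m g(1) by (auto simp: adjoin_def greatest_def)
    ultimately show ?thesis by blast
  qed
  have "adjoin L F b \<subseteq> carrier L" by (auto simp: adjoin_def)
  moreover have "adjoin L F b \<noteq> {}" using mem_adjoin[OF F b] by auto
  ultimately show ?thesis using up dir unfolding directed_filter_def by simp
qed

section \<open>Separation by prime filters\<close>

text \<open>
  Meet distributivity requires that \<open>f \<and> (b \<or> c)\<close> exists, and below \<open>b \<or> c\<close> this is automatic,
  because the meet is \<open>f\<close> itself.
\<close>

lemma meet_distributive_decompose:
  assumes md: "meet_distributive L" and bc: "b \<in> carrier L" "c \<in> carrier L"
    and d: "is_lub L d {b, c}" and f: "f \<in> carrier L" "f \<sqsubseteq> d"
  obtains x y where "is_glb L x {f, b}" "is_glb L y {f, c}" "is_lub L f {x, y}"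
proof -
  have "is_glb L f {f, d}"
    using d f by (simp add: is_glb_pair_iff least_def Upper_def)
  then show thesis
    using md bc d f(1) that unfolding meet_distributive_def by blast
qed

text \<open>
  Maximality among the directed filters omitting \<open>q\<close> suffices for primeness: every proper extension
  contains \<open>q\<close>, in particular those obtained by adjoining \<open>b\<close> and \<open>c\<close>.
\<close>

lemma maximal_directed_filter_prime:
  assumes md: "meet_distributive L" and F: "directed_filter L F"
    and q: "q \<in> carrier L" "q \<notin> F"
    and max: "\<And>G. directed_filter L G \<Longrightarrow> F \<subseteq> G \<Longrightarrow> q \<notin> G \<Longrightarrow> G = F"
  shows "prime_filter L F"
proof -
  have carr: "F \<subseteq> carrier L" using F by (simp add: directed_filter_def)
  have bot: "j \<notin> F" if "is_lub L j {}" for j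
    using that F q by (auto simp: directed_filter_def least_def Upper_def)
  have prime: "b \<in> F \<or> c \<in> F"
    if bc: "b \<in> carrier L" "c \<in> carrier L" and d: "is_lub L d {b, c}" "d \<in> F" for b c d
  proof (rule ccontr)
    assume neg: "\<not> (b \<in> F \<or> c \<in> F)"
    have below: "\<exists>g\<in>F. g \<sqsubseteq> f \<and> g \<sqsubseteq> d" if "f \<in> F" for f
      using F d(2) that unfolding directed_filter_def by blast
    have coinitial: "\<exists>g\<in>F. g \<sqsubseteq> f \<and> (\<exists>m. is_glb L m {g, b}) \<and> (\<exists>m. is_glb L m {g, c})"
      if "f \<in> F" for f
      using below[OF that] meet_distributive_decompose[OF md bc d(1)] carr by (meson subsetD)
    have q_adjoin: "q \<in> adjoin L F e" if e: "e = b \<or> e = c" for e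
    proof (rule ccontr)
      assume "q \<notin> adjoin L F e"
      moreover have "e \<in> carrier L" using e bc by auto
      moreover have "\<exists>g\<in>F. g \<sqsubseteq> f \<and> (\<exists>m. is_glb L m {g, e})" if "f \<in> F" for f
        using coinitial[OF that] e by blast
      ultimately have "adjoin L F e = F"
        using max directed_filter_adjoin[OF F] subset_adjoin[OF F] by simp
      then show False using mem_adjoin[OF F \<open>e \<in> carrier L\<close>] neg e by auto
    qed
    obtain f where f: "f \<in> F" "\<forall>l\<in>Lower L {f, b}. l \<sqsubseteq> q"
      using q_adjoin[of b] by (auto simp: adjoin_def)
    obtain f' where f': "f' \<in> F" "\<forall>l\<in>Lower L {f', c}. l \<sqsubseteq> q"
      using q_adjoin[of c] by (auto simp: adjoin_def)
    have "\<exists>g\<in>F. \<forall>s\<in>{f, f', d}. g \<sqsubseteq> s"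
      using directed_filter_finite_lower_bound[OF F, of "{f, f', d}"] f f' d by auto
    then obtain g where g: "g \<in> F" "g \<sqsubseteq> f" "g \<sqsubseteq> f'" "g \<sqsubseteq> d" by auto
    have in_carr: "f \<in> carrier L" "f' \<in> carrier L" "g \<in> carrier L"
      using f(1) f'(1) g(1) carr by blast+
    obtain x y where xy: "is_glb L x {g, b}" "is_glb L y {g, c}" "is_lub L g {x, y}"
      using meet_distributive_decompose[OF md bc d(1) in_carr(3) g(4)] by blast
    have x: "x \<in> carrier L" "x \<sqsubseteq> g" "x \<sqsubseteq> b" and y: "y \<in> carrier L" "y \<sqsubseteq> g" "y \<sqsubseteq> c"
      using xy(1,2) in_carr bc by (simp_all add: is_glb_pair_iff)
    have "x \<sqsubseteq> f" using le_trans[OF x(2) g(2)] x in_carr by simp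
    moreover have "y \<sqsubseteq> f'" using le_trans[OF y(2) g(3)] y in_carr by simp
    ultimately have "x \<in> Lower L {f, b}" "y \<in> Lower L {f', c}"
      using x y in_carr bc by (simp_all add: Lower_pair_iff)
    then have "x \<sqsubseteq> q" "y \<sqsubseteq> q" using f f' by auto
    then have "g \<sqsubseteq> q"
      using xy(3) x y q by (simp add: is_lub_pair_iff)
    then show False using F g(1) q by (auto simp: directed_filter_def)
  qed
  show ?thesis using F bot prime unfolding prime_filter_def by blast
qed

lemma directed_filter_Union_chain:
  assumes "C \<noteq> {}" and filters: "\<And>F. F \<in> C \<Longrightarrow> directed_filter L F"
    and chain: "\<And>F G. F \<in> C \<Longrightarrow> G \<in> C \<Longrightarrow> F \<subseteq> G \<or> G \<subseteq> F"
  shows "directed_filter L (\<Union>C)"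
proof -
  have "\<exists>z\<in>\<Union>C. z \<sqsubseteq> x \<and> z \<sqsubseteq> y" if xy: "x \<in> \<Union>C" "y \<in> \<Union>C" for x y
  proof -
    obtain H where "H \<in> C" "x \<in> H" "y \<in> H" using xy chain by blast
    then show ?thesis using filters[of H] unfolding directed_filter_def by blast
  qed
  moreover have "\<Union>C \<subseteq> carrier L" using filters unfolding directed_filter_def by blast
  moreover have "\<Union>C \<noteq> {}" using assms(1) filters unfolding directed_filter_def by blast
  moreover have "y \<in> \<Union>C" if "x \<in> \<Union>C" "y \<in> carrier L" "x \<sqsubseteq> y" for x y
    using that filters unfolding directed_filter_def by blast
  ultimately show ?thesis unfolding directed_filter_def by blast
qed

lemma prime_filter_separation:
  assumes md: "meet_distributive L" and pq: "p \<in> carrier L" "q \<in> carrier L" "\<not> p \<sqsubseteq> q"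
  obtains F where "prime_filter L F" "p \<in> F" "q \<notin> F"
proof -
  define A where "A = {F. directed_filter L F \<and> p \<in> F \<and> q \<notin> F}"
  have "{x \<in> carrier L. p \<sqsubseteq> x} \<in> A"
    using directed_filter_principal[OF pq(1)] pq by (auto simp: A_def)
  moreover have "\<Union>C \<in> A" if "C \<noteq> {}" "subset.chain A C" for C
  proof -
    have "directed_filter L (\<Union>C)"
      using that by (intro directed_filter_Union_chain) (auto simp: A_def subset_chain_def)
    then show ?thesis using that by (auto simp: A_def subset_chain_def)
  qed
  ultimately obtain F where F: "F \<in> A" and max: "\<And>G. G \<in> A \<Longrightarrow> F \<subseteq> G \<Longrightarrow> G = F"
    using subset_Zorn_nonempty[of A] by blast
  have "prime_filter L F"
    by (rule maximal_directed_filter_prime[OF md _ pq(2)])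
      (use F max in \<open>auto simp: A_def\<close>)
  then show thesis using that F by (auto simp: A_def)
qed

end

section \<open>The representation by prime filters\<close>

theorem corollary4p5:
  fixes P :: "('a, 'm) gorder_scheme"
  assumes "partial_order P"
    and "meet_distributive P"
  shows "representable natLeq |{..<3::nat}| P"
proof -
  interpret partial_order P by fact
  define X where "X = {F. prime_filter P F}"
  define h where "h a = {F \<in> X. a \<in> F}" for a
  have directed: "directed_filter P F" if "F \<in> X" for F
    using that by (simp add: X_def prime_filter_def)
  have "h a \<subseteq> h b \<longleftrightarrow> a \<sqsubseteq>\<^bsub>P\<^esub> b" if ab: "a \<in> carrier P" "b \<in> carrier P" for a b
  proof
    assume sub: "h a \<subseteq> h b"
    show "a \<sqsubseteq>\<^bsub>P\<^esub> b"
    proof (rule ccontr)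
      assume "\<not> a \<sqsubseteq>\<^bsub>P\<^esub> b"
      then obtain F where "prime_filter P F" "a \<in> F" "b \<notin> F"
        using prime_filter_separation[OF assms(2) ab] by blast
      then show False using sub by (auto simp: h_def X_def)
    qed
  next
    assume "a \<sqsubseteq>\<^bsub>P\<^esub> b"
    then show "h a \<subseteq> h b" using directed ab by (auto simp: h_def directed_filter_def)
  qed
  moreover have "weak_partial_order (powerset_algebra X)"
    by unfold_locales (auto simp: powerset_algebra_def)
  ultimately have "order_emb P (powerset_algebra X) h"
    using weak_partial_order_axioms by (simp add: order_emb_def powerset_algebra_def)
  moreover have "h m = X \<inter> \<Inter>(h ` S)"
    if "S \<subseteq> carrier P" "|S| <o natLeq" "is_glb P m S" for S m
  proof -
    have "m \<in> F \<longleftrightarrow> S \<subseteq> F" if "F \<in> X" for F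
      using directed_filter_is_glb_iff[OF directed[OF that]] \<open>S \<subseteq> carrier P\<close>
        \<open>|S| <o natLeq\<close> \<open>is_glb P m S\<close> by (simp add: finite_iff_ordLess_natLeq)
    then show ?thesis by (auto simp: h_def)
  qed
  moreover have "h j = \<Union>(h ` S)"
    if "S \<subseteq> carrier P" "|S| <o |{..<3::nat}|" "is_lub P j S" for S j
  proof -
    have "j \<in> F \<longleftrightarrow> S \<inter> F \<noteq> {}" if "F \<in> X" for F
      using prime_filter_is_lub_iff[of F S j] that \<open>S \<subseteq> carrier P\<close>
        \<open>|S| <o |{..<3::nat}|\<close> \<open>is_lub P j S\<close> by (simp add: card_of_less_nat_iff X_def)
    then show ?thesis by (auto simp: h_def)
  qed
  moreover have "h \<in> carrier P \<rightarrow> carrier (powerset_algebra X)"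
    by (auto simp: h_def powerset_algebra_def)
  ultimately have "representation natLeq |{..<3::nat}| P X h"
    unfolding representation_def by simp
  then show ?thesis unfolding representable_def by blast
qed

end
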